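(* Let $p$ be a prime number. Let $v,t,k$ be non-negative integers with base-$p$ expansions $k=\sum_{i=0}^{k(p)} k_i p^i$ and $t=\sum_{i=0}^{t(p)} t_i p^i$, and assume $t\leq \min(k,v-k)$. Let $V$ be a set with $v$ elements and let $W_{t\,k}$ be the $\binom{v}{t}\times\binom{v}{k}$ matrix whose rows are indexed by the $t$-element subsets $T$ of $V$, columns by the $k$-element subsets $K$ of $V$, with entry $1$ if $T\subseteq K$ and $0$ otherwise; let ${}^tW_{t\,k}$ be its transpose, considered over the field $\mathbb{Z}/p\mathbb{Z}$. Then: 1) $k_j=t_j$ for all $j<t(p)$ and $k_{t(p)}\geq t_{t(p)}$ if and only if $\mathrm{Ker}({}^tW_{t\,k})=\{0\}$ over $\mathbb{Z}/p\mathbb{Z}$. 2) $t=t_{t(p)}p^{t(p)}$ and $k=\sum_{i=t(p)+1}^{k(p)} k_i p^i$ if and only if $\dim \mathrm{Ker}({}^tW_{t\,k})=1$ over $\mathbb{Z}/p\mathbb{Z}$ and $\{(1,1,\dots,1)\}$ is a basis of $\mathrm{Ker}({}^tW_{t\,k})$.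
   Context: For a positive integer $n$, $n=\sum_{i=0}^{n(p)} n_i p^i$ denotes its expansion in base $p$, with digits in $\{0,\dots,p-1\}$ and $n_{n(p)}\neq 0$ when $n\neq 0$.
   Formalization: Part 2 is stated only for t > 0: for t = 0 and p dividing k (e.g. k = t = 0) its left-hand conditions hold while the kernel is {0}, so the equivalence fails there. *)

theory Defs
  imports
    "Berlekamp_Zassenhaus.Finite_Field"
    "Jordan_Normal_Form.Matrix_Kernel"
begin

definition base_digit :: "nat \<Rightarrow> nat \<Rightarrow> nat \<Rightarrow> nat" where
  "base_digit p n i = n div p ^ i mod p"

text \<open>
  Index \<open>n(p)\<close> of the leading base-\<open>p\<close> digit of \<open>n\<close>; by convention \<open>0\<close> for \<open>n = 0\<close>,
  whose expansion then has the single digit \<open>0\<close>.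
\<close>

definition base_top :: "nat \<Rightarrow> nat \<Rightarrow> nat" where
  "base_top p n = (if n = 0 then 0 else GREATEST i. base_digit p n i \<noteq> 0)"

lemma base_digit_less: "p > 0 \<Longrightarrow> base_digit p n i < p"
  by (simp add: base_digit_def)

lemma base_expansion_mod: "n mod p ^ m = (\<Sum>i<m. base_digit p n i * p ^ i)"
proof (induction m)
  case (Suc m)
  have "n mod p ^ Suc m = p ^ m * (n div p ^ m mod p) + n mod p ^ m"
    by (simp only: power_Suc2 mod_mult2_eq)
  with Suc show ?case by (simp add: base_digit_def)
qed simp

lemma base_digit_nz_le:
  assumes "p \<ge> 2" "base_digit p n i \<noteq> 0"
  shows "i \<le> n"
proof -
  have "n div p ^ i \<noteq> 0" using assms(2) by (metis base_digit_def mod_0)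
  hence "p ^ i \<le> n" by (metis div_less not_le)
  moreover have "i < 2 ^ i" by simp
  moreover have "(2::nat) ^ i \<le> p ^ i" using assms(1) by (simp add: power_mono)
  ultimately show ?thesis by linarith
qed

lemma base_digit_above_top:
  assumes "p \<ge> 2" "base_top p n < i"
  shows "base_digit p n i = 0"
proof (rule ccontr)
  assume nz: "base_digit p n i \<noteq> 0"
  hence "n \<noteq> 0" by (metis base_digit_def div_0 mod_0)
  moreover have "i \<le> (GREATEST i. base_digit p n i \<noteq> 0)"
    using Greatest_le_nat[of "\<lambda>i. base_digit p n i \<noteq> 0", OF nz] base_digit_nz_le[OF assms(1)] by blast
  ultimately show False using assms(2) by (simp add: base_top_def)
qed

lemma base_expansion:
  assumes "p \<ge> 2"
  shows "n = (\<Sum>i\<le>base_top p n. base_digit p n i * p ^ i)"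
proof -
  define m where "m = Suc (max n (base_top p n))"
  have "n < 2 ^ n" by simp
  also have "\<dots> \<le> p ^ n" using assms by (simp add: power_mono)
  also have "\<dots> \<le> p ^ m" using assms by (intro power_increasing) (auto simp: m_def)
  finally have "n = (\<Sum>i<m. base_digit p n i * p ^ i)"
    using base_expansion_mod[of n p m] by simp
  also have "\<dots> = (\<Sum>i\<le>base_top p n. base_digit p n i * p ^ i)"
    by (rule sum.mono_neutral_right) (auto simp: m_def base_digit_above_top[OF assms])
  finally show ?thesis .
qed

lemma base_digit_top_nz:
  assumes "p \<ge> 2" "n \<noteq> 0"
  shows "base_digit p n (base_top p n) \<noteq> 0"
proof -
  obtain i where "base_digit p n i \<noteq> 0"
    using base_expansion[OF assms(1), of n] assms(2)
    by (metis (no_types, lifting) mult_zero_left sum.neutral)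
  thus ?thesis
    using GreatestI_nat[of "\<lambda>i. base_digit p n i \<noteq> 0"] base_digit_nz_le[OF assms(1)] assms(2)
    by (auto simp: base_top_def)
qed

definition subsets_of_card :: "'a set \<Rightarrow> nat \<Rightarrow> 'a set set" where
  "subsets_of_card V t = {T. T \<subseteq> V \<and> card T = t}"

text \<open>
  Matrices are indexed by natural numbers, so the rows and columns of the inclusion matrix are
  labelled by enumerations of the \<open>t\<close>-element and the \<open>k\<close>-element subsets of \<open>V\<close>.
\<close>

definition enumerates :: "(nat \<Rightarrow> 'b) \<Rightarrow> 'b set \<Rightarrow> bool" where
  "enumerates f S \<longleftrightarrow> bij_betw f {..<card S} S"

definition inclusion_mat ::
  "'a set \<Rightarrow> nat \<Rightarrow> nat \<Rightarrow> (nat \<Rightarrow> 'a set) \<Rightarrow> (nat \<Rightarrow> 'a set) \<Rightarrow> 'b::zero_neq_one mat" where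
  "inclusion_mat V t k rs cs =
     mat (card V choose t) (card V choose k) (\<lambda>(i, j). if rs i \<subseteq> cs j then 1 else 0)"

lemma card_subsets_of_card: "finite V \<Longrightarrow> card (subsets_of_card V t) = card V choose t"
  by (simp add: subsets_of_card_def n_subsets)

lemma ex_enumerates: "finite S \<Longrightarrow> \<exists>f. enumerates f S"
  using ex_bij_betw_nat_finite[of S] by (auto simp: enumerates_def atLeast0LessThan)

end

theory Submission
  imports Defs
begin

text \<open>
  Call a function \<open>f\<close> on \<open>t\<close>-subsets null if its sum over the \<open>t\<close>-subsets of every \<open>k\<close>-subset vanishes;
  these are the kernel vectors. If \<open>f\<close> is null and \<open>x \<noteq> y\<close>, then \<open>T \<mapsto> f (T \<union> {x}) - f (T \<union> {y})\<close> is
  null on \<open>V - {x, y}\<close> for \<open>(t - 1, k - 1)\<close>. By induction on \<open>t\<close>, if no \<open>(k - i) choose (t - i)\<close> with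
  \<open>1 \<le> i \<le> t\<close> is divisible by \<open>p\<close>, these differences vanish and \<open>f\<close> is constant. Conversely, if
  \<open>p\<close> divides \<open>(k - i) choose (t - i)\<close> and \<open>I\<close> has \<open>i\<close> elements, the indicator of the \<open>t\<close>-subsets
  containing \<open>I\<close> is null. So both parts depend only on which of these binomials vanish modulo \<open>p\<close>.

  With \<open>d = k - t\<close> these are the numbers \<open>(d + j) choose j\<close>, \<open>j \<le> t\<close>. Each arises from the
  preceding one by the factor \<open>(d + j) / j\<close>, so none is divisible by \<open>p\<close> iff \<open>d + j\<close> and \<open>j\<close> have
  the same \<open>p\<close>-adic valuation for \<open>0 < j \<le> t\<close>, which is a condition on base-\<open>p\<close> digits.
\<close>

section \<open>Divisibility of binomial coefficients and base-\<open>p\<close> digits\<close>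

text \<open>Absorption relates consecutive coefficients: while the one at \<open>t\<close> is prime
  to \<open>p\<close>, the next one stays so exactly when \<open>d + Suc t\<close> and
  \<open>Suc t\<close> have the same valuation.\<close>

lemma choose_not_dvd_iff:
  fixes p d t :: nat
  assumes "prime p"
  shows "(\<forall>j\<le>t. \<not> p dvd (d + j) choose j) \<longleftrightarrow>
    (\<forall>i. 0 < i \<and> i \<le> t \<longrightarrow> multiplicity p (d + i) = multiplicity p i)"
proof (induction t)
  case 0
  then show ?case using assms by auto
next
  case (Suc t)
  have "Suc t * (d + Suc t choose Suc t) = (d + Suc t) * (d + t choose t)"
    using Suc_times_binomial[of t "d + t"] by simp
  hence "multiplicity p (Suc t * (d + Suc t choose Suc t)) = multiplicity p ((d + Suc t) * (d + t choose t))"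
    by (simp only:)
  hence mult: "multiplicity p (Suc t) + multiplicity p (d + Suc t choose Suc t)
      = multiplicity p (d + Suc t) + multiplicity p (d + t choose t)"
    using assms by (subst (asm) (1 2) prime_elem_multiplicity_mult_distrib) auto
  have not_dvd: "\<not> p dvd (d + j choose j) \<longleftrightarrow> multiplicity p (d + j choose j) = 0" for j
    using assms by (subst multiplicity_eq_zero_iff) auto
  show ?case
  proof (cases "p dvd (d + t choose t)")
    \<comment> \<open>Both sides fail here: the left at \<open>j = t\<close>, the right by the
      induction hypothesis.\<close>
    case True
    then show ?thesis using Suc.IH by (meson le_SucI order_refl)
  next
    case False
    hence "\<not> p dvd (d + Suc t choose Suc t) \<longleftrightarrow>
        multiplicity p (d + Suc t) = multiplicity p (Suc t)"
      using mult not_dvd[of t] not_dvd[of "Suc t"] by auto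
    then show ?thesis using Suc.IH unfolding le_Suc_eq by auto
  qed
qed

lemma multiplicity_eqI_dvd:
  fixes p a b :: nat
  assumes "prime p" "a \<noteq> 0" "b \<noteq> 0" "\<And>n. p ^ n dvd a \<longleftrightarrow> p ^ n dvd b"
  shows "multiplicity p a = multiplicity p b"
proof (rule antisym)
  have "\<not> is_unit p" using assms(1) by auto
  thus "multiplicity p a \<le> multiplicity p b" "multiplicity p b \<le> multiplicity p a"
    using assms by (metis multiplicity_dvd multiplicity_geI)+
qed

lemma power_dvd_iff_of_multiplicity_eq:
  fixes p a b :: nat
  assumes "prime p" "a \<noteq> 0" "b \<noteq> 0" "multiplicity p a = multiplicity p b"
  shows "p ^ n dvd a \<longleftrightarrow> p ^ n dvd b"
proof -
  have "\<not> is_unit p" using assms(1) by auto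
  thus ?thesis using assms by (simp add: power_dvd_iff_le_multiplicity)
qed

text \<open>Powers up to \<open>p ^ s\<close> divide \<open>d + i\<close> and \<open>i\<close> alike
  once they divide \<open>d\<close>. Higher powers divide no positive \<open>i <= t\<close>, so they
  must not divide \<open>d + i\<close> either: the next multiple of \<open>p ^ Suc s\<close> after
  \<open>d\<close> has to lie beyond \<open>d + t\<close>.\<close>

lemma multiplicity_shift_iff:
  fixes p d t s :: nat
  assumes p: "prime p" and st: "p ^ s \<le> t" "t < p ^ Suc s"
  shows "(\<forall>i. 0 < i \<and> i \<le> t \<longrightarrow> multiplicity p (d + i) = multiplicity p i) \<longleftrightarrow>
    p ^ s dvd d \<and> d mod p ^ Suc s + t < p ^ Suc s"
proof safe
  have p0: "p > 0" using p by (simp add: prime_gt_0_nat)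
  assume *: "\<forall>i. 0 < i \<and> i \<le> t \<longrightarrow> multiplicity p (d + i) = multiplicity p i"
  have dvd_iff: "p ^ n dvd d + i \<longleftrightarrow> p ^ n dvd i" if "0 < i" "i \<le> t" for i n
    using that * p by (intro power_dvd_iff_of_multiplicity_eq) auto
  have "p ^ s dvd d + p ^ s" using dvd_iff[of "p ^ s" s] st p0 by simp
  thus "p ^ s dvd d" by simp
  show "d mod p ^ Suc s + t < p ^ Suc s"
  proof (rule ccontr)
    assume ge: "\<not> ?thesis"
    \<comment> \<open>The least positive shift taking \<open>d\<close> to a multiple of
      \<open>p ^ Suc s\<close>; the failed bound gives \<open>i <= t\<close>.\<close>
    define i where "i = p ^ Suc s - d mod p ^ Suc s"
    have lt: "d mod p ^ Suc s < p ^ Suc s" using p0 by (intro mod_less_divisor) simp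
    have i: "0 < i" "i \<le> t" using ge lt unfolding i_def by linarith+
    have "d + i = p ^ Suc s * (d div p ^ Suc s) + p ^ Suc s"
      using lt mult_div_mod_eq[of "p ^ Suc s" d] unfolding i_def by linarith
    hence "p ^ Suc s dvd d + i" by (metis dvd_add dvd_refl dvd_triv_left)
    hence "p ^ Suc s dvd i" using dvd_iff i by blast
    thus False using i st by (meson dvd_imp_le le_trans not_le)
  qed
next
  fix i assume d: "p ^ s dvd d" "d mod p ^ Suc s + t < p ^ Suc s" and i: "0 < i" "i \<le> t"
  show "multiplicity p (d + i) = multiplicity p i"
  proof (rule multiplicity_eqI_dvd[OF p])
    fix n
    show "p ^ n dvd d + i \<longleftrightarrow> p ^ n dvd i"
    proof (cases "n \<le> s")
      case True
      hence "p ^ n dvd d" using d(1) by (meson dvd_trans le_imp_power_dvd)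
      thus ?thesis by (simp add: dvd_add_right_iff)
    next
      case False
      hence n: "p ^ Suc s dvd p ^ n" by (intro le_imp_power_dvd) simp
      have "\<not> p ^ Suc s dvd i" using i st by (meson dvd_imp_le le_trans not_le)
      moreover have "(d + i) mod p ^ Suc s = d mod p ^ Suc s + i"
        using d i by (metis add_le_cancel_left le_less_trans mod_add_left_eq mod_less)
      hence "\<not> p ^ Suc s dvd d + i" using i by (simp add: dvd_eq_mod_eq_0)
      ultimately show ?thesis using n by (meson dvd_trans)
    qed
  qed (use i in auto)
qed

text \<open>For nonzero \<open>d\<close> of valuation \<open>e\<close>, the valuations of
  \<open>d + i\<close> and \<open>i\<close> can differ only if \<open>p ^ e\<close> divides
  \<open>i\<close>, and they do differ at some positive \<open>i < p ^ Suc e\<close>. A first change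
  at \<open>t\<close> thus forces \<open>p ^ e <= t < p ^ Suc e\<close>, that is,
  \<open>e = s\<close>.\<close>

lemma first_multiplicity_change_iff:
  fixes p d t s :: nat
  assumes p: "prime p" and st: "p ^ s \<le> t" "t < p ^ Suc s"
  shows "(\<forall>i. 0 < i \<and> i < t \<longrightarrow> multiplicity p (d + i) = multiplicity p i)
      \<and> multiplicity p (d + t) \<noteq> multiplicity p t \<longleftrightarrow>
    p ^ s dvd t \<and> p ^ Suc s dvd d + t"
proof (intro iffI; elim conjE)
  have p0: "p > 0" and nu: "\<not> is_unit p" using p by (auto simp: prime_gt_0_nat)
  have t0: "t > 0" using st p0 by (metis zero_less_power less_le_trans)
  assume before: "\<forall>i. 0 < i \<and> i < t \<longrightarrow> multiplicity p (d + i) = multiplicity p i"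
    and change: "multiplicity p (d + t) \<noteq> multiplicity p t"
  have d0: "d \<noteq> 0" using change by (metis add_0)
  define e where "e = multiplicity p d"
  have ed: "p ^ e dvd d" "\<not> p ^ Suc e dvd d"
    using d0 nu power_dvd_iff_le_multiplicity[of d p "Suc e"]
    by (simp_all only: e_def multiplicity_dvd) simp
  have et: "p ^ e dvd t"
  proof (rule ccontr)
    assume e: "\<not> ?thesis"
    have "p ^ n dvd d + t \<longleftrightarrow> p ^ n dvd t" for n
    proof (cases "n \<le> e")
      case True
      hence "p ^ n dvd d" using ed(1) by (meson dvd_trans le_imp_power_dvd)
      thus ?thesis by (simp add: dvd_add_right_iff)
    next
      case False
      hence "p ^ e dvd p ^ n" by (intro le_imp_power_dvd) simp
      moreover have "\<not> p ^ e dvd d + t" using ed e by (simp add: dvd_add_right_iff)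
      ultimately show ?thesis using e by (meson dvd_trans)
    qed
    hence "multiplicity p (d + t) = multiplicity p t"
      using t0 by (intro multiplicity_eqI_dvd[OF p]) auto
    thus False using change by simp
  qed
  define r where "r = d mod p ^ Suc e"
  have "r \<noteq> 0" using ed(2) by (simp only: r_def dvd_eq_mod_eq_0 not_False_eq_True)
  moreover have "r < p ^ Suc e" unfolding r_def using p0 by (intro mod_less_divisor) simp
  ultimately have r: "0 < r" "r < p ^ Suc e" by simp_all
  \<comment> \<open>\<open>p ^ Suc e\<close> divides \<open>d + i\<close> but not \<open>i\<close>,
    because \<open>r\<close> is nonzero. The valuations differ at this \<open>i\<close>, so
    \<open>t <= i\<close>.\<close>
  define i where "i = p ^ Suc e - r"
  have i: "0 < i" "i < p ^ Suc e" using r by (auto simp: i_def)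
  have "d + i = p ^ Suc e * (d div p ^ Suc e) + p ^ Suc e"
    using r(2) mult_div_mod_eq[of "p ^ Suc e" d] unfolding i_def r_def by linarith
  hence "p ^ Suc e dvd d + i" by (metis dvd_add dvd_refl dvd_triv_left)
  moreover have "\<not> p ^ Suc e dvd i" using i by (meson dvd_imp_le not_le)
  ultimately have "multiplicity p (d + i) \<noteq> multiplicity p i"
    using i d0 power_dvd_iff_of_multiplicity_eq[OF p, of "d + i" i "Suc e"] by auto
  hence "t \<le> i" using before i by (meson not_le)
  hence "t < p ^ Suc e" using i by simp
  moreover have "p ^ e \<le> t" using et t0 by (simp add: dvd_imp_le)
  moreover have p1: "p > 1" using p prime_gt_1_nat by blast
  ultimately have "p ^ e < p ^ Suc s" "p ^ s < p ^ Suc e" using st by linarith+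
  hence "e < Suc s" "s < Suc e" using p1 power_less_imp_less_exp by blast+
  hence es: "e = s" by simp
  \<comment> \<open>Otherwise no power above \<open>p ^ s\<close> divides \<open>t\<close> or
    \<open>d + t\<close>, while powers up to \<open>p ^ s\<close> divide both or neither, so nothing
    changes at \<open>t\<close>.\<close>
  have "p ^ Suc s dvd d + t"
  proof (rule ccontr)
    assume not_dvd: "\<not> ?thesis"
    have "p ^ n dvd d + t \<longleftrightarrow> p ^ n dvd t" for n
    proof (cases "n \<le> s")
      case True
      hence "p ^ n dvd d" using ed(1) es by (meson dvd_trans le_imp_power_dvd)
      thus ?thesis by (simp add: dvd_add_right_iff)
    next
      case False
      hence "p ^ Suc s dvd p ^ n" by (intro le_imp_power_dvd) simp
      moreover have "\<not> p ^ Suc s dvd t" using st t0 by (meson dvd_imp_le not_le)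
      ultimately show ?thesis using not_dvd by (meson dvd_trans)
    qed
    hence "multiplicity p (d + t) = multiplicity p t"
      using t0 by (intro multiplicity_eqI_dvd[OF p]) auto
    thus False using change by simp
  qed
  thus "p ^ s dvd t \<and> p ^ Suc s dvd d + t" using et es by simp
next
  have p0: "p > 0" using p by (simp add: prime_gt_0_nat)
  have t0: "t > 0" using st p0 by (metis zero_less_power less_le_trans)
  assume t: "p ^ s dvd t" and k: "p ^ Suc s dvd d + t"
  have d: "p ^ s dvd d"
    using t k by (metis dvd_add_left_iff dvd_trans le_imp_power_dvd le_SucI order_refl)
  have "multiplicity p (d + i) = multiplicity p i" if i: "0 < i" "i < t" for i
  proof (rule multiplicity_eqI_dvd[OF p])
    fix n
    show "p ^ n dvd d + i \<longleftrightarrow> p ^ n dvd i"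
    proof (cases "n \<le> s")
      case True
      hence "p ^ n dvd d" using d by (meson dvd_trans le_imp_power_dvd)
      thus ?thesis by (simp add: dvd_add_right_iff)
    next
      case False
      hence n: "p ^ Suc s dvd p ^ n" by (intro le_imp_power_dvd) simp
      have "\<not> p ^ Suc s dvd i" using i st by (meson dvd_imp_le le_trans not_le less_imp_le)
      moreover have "\<not> p ^ Suc s dvd d + i"
      proof
        assume "p ^ Suc s dvd d + i"
        \<comment> \<open>Two multiples of \<open>p ^ Suc s\<close> cannot differ by the positive
          number \<open>t - i < p ^ Suc s\<close>.\<close>
        hence "p ^ Suc s dvd (d + t) - (d + i)" using k by (rule dvd_diff_nat[rotated])
        hence "p ^ Suc s \<le> t - i" using i by (intro dvd_imp_le) auto
        thus False using st by linarith
      qed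
      ultimately show ?thesis using n by (meson dvd_trans)
    qed
  qed (use i in auto)
  moreover have "multiplicity p (d + t) \<noteq> multiplicity p t"
  proof
    assume "multiplicity p (d + t) = multiplicity p t"
    hence "p ^ Suc s dvd t" using k t0 power_dvd_iff_of_multiplicity_eq[OF p, of "d + t" t "Suc s"] by auto
    thus False using st t0 by (meson dvd_imp_le not_le)
  qed
  ultimately show "(\<forall>i. 0 < i \<and> i < t \<longrightarrow> multiplicity p (d + i) = multiplicity p i)
      \<and> multiplicity p (d + t) \<noteq> multiplicity p t" by blast
qed

section \<open>Translating the divisibility conditions into base-\<open>p\<close> digits\<close>

lemma base_digit_mod_power:
  assumes "p > 0" "i < m"
  shows "base_digit p (n mod p ^ m) i = base_digit p n i"
proof -
  have m: "p ^ m = p ^ i * p ^ (m - i)" using assms(2) by (metis le_add_diff_inverse less_imp_le power_add)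
  have "n mod p ^ m div p ^ i = n div p ^ i mod p ^ (m - i)"
    unfolding m using assms(1) by (auto simp: mod_mult2_eq)
  moreover have "p dvd p ^ (m - i)" using assms(2) by (intro dvd_power) auto
  ultimately show ?thesis by (simp add: base_digit_def mod_mod_cancel)
qed

lemma mod_power_eq_iff_base_digit:
  assumes "p > 0"
  shows "m mod p ^ s = n mod p ^ s \<longleftrightarrow> (\<forall>i<s. base_digit p m i = base_digit p n i)"
proof
  assume "m mod p ^ s = n mod p ^ s"
  thus "\<forall>i<s. base_digit p m i = base_digit p n i" using assms by (metis base_digit_mod_power)
qed (simp add: base_expansion_mod)

text \<open>With \<open>power_base_top_le\<close> this places a nonzero \<open>n\<close> between
  consecutive powers of \<open>p\<close>, as the valuation lemmas require of
  \<open>t\<close>.\<close>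

lemma less_power_Suc_base_top:
  assumes "p \<ge> 2"
  shows "n < p ^ Suc (base_top p n)"
proof -
  have "n = n mod p ^ Suc (base_top p n)"
    using base_expansion[OF assms, of n] unfolding base_expansion_mod lessThan_Suc_atMost .
  thus ?thesis using assms by (metis mod_less_divisor zero_less_power pos2 less_le_trans)
qed

lemma power_base_top_le:
  assumes "p \<ge> 2" "n \<noteq> 0"
  shows "p ^ base_top p n \<le> n"
  using base_digit_top_nz[OF assms] by (metis base_digit_def div_less mod_0 not_le)

text \<open>Agreement of the low digits is congruence modulo \<open>p ^ s\<close>. Given that,
  comparing the digits at \<open>s\<close> amounts to comparing \<open>t\<close> with
  \<open>k mod p ^ Suc s\<close>, which is at least \<open>t\<close> exactly when adding
  \<open>t\<close> to \<open>(k - t) mod p ^ Suc s\<close> does not wrap around.\<close>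

lemma base_digits_condition_iff:
  fixes p k t s :: nat
  assumes p: "p > 0" and t: "t < p ^ Suc s" "t \<le> k"
  shows "(\<forall>j<s. base_digit p k j = base_digit p t j) \<and> base_digit p t s \<le> base_digit p k s \<longleftrightarrow>
    p ^ s dvd k - t \<and> (k - t) mod p ^ Suc s + t < p ^ Suc s"
proof -
  define d where "d = k - t"
  have k: "k = d + t" using t by (simp add: d_def)
  have digits: "(\<forall>j<s. base_digit p k j = base_digit p t j) \<longleftrightarrow> p ^ s dvd d"
    unfolding mod_power_eq_iff_base_digit[OF p, symmetric] d_def using t(2) by (simp add: mod_eq_dvd_iff_nat)
  show ?thesis
  proof (cases "p ^ s dvd d")
    case False
    thus ?thesis using digits by (simp add: d_def)
  next
    case True
    hence low: "k mod p ^ s = t mod p ^ s" using digits mod_power_eq_iff_base_digit[OF p] by blast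
    have split: "n mod p ^ Suc s = p ^ s * base_digit p n s + n mod p ^ s" for n
      by (simp only: base_digit_def power_Suc2 mod_mult2_eq)
    have "base_digit p t s \<le> base_digit p k s \<longleftrightarrow> t mod p ^ Suc s \<le> k mod p ^ Suc s"
      unfolding split low using p by simp
    also have "t mod p ^ Suc s = t" using t by simp
    also have "t \<le> k mod p ^ Suc s \<longleftrightarrow> d mod p ^ Suc s + t < p ^ Suc s"
    proof (cases "d mod p ^ Suc s + t < p ^ Suc s")
      case True
      hence "k mod p ^ Suc s = d mod p ^ Suc s + t"
        unfolding k by (metis mod_add_left_eq mod_less)
      thus ?thesis using True by simp
    next
      case False
      have lt: "d mod p ^ Suc s < p ^ Suc s" using p by (intro mod_less_divisor) simp
      have "k mod p ^ Suc s = (d mod p ^ Suc s + t) mod p ^ Suc s"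
        unfolding k by (metis mod_add_left_eq)
      \<comment> \<open>Both summands are below \<open>p ^ Suc s\<close>, so one subtraction reduces
        the sum, and the residue is smaller than \<open>t\<close>.\<close>
      also have "\<dots> = d mod p ^ Suc s + t - p ^ Suc s"
        using False lt t(1) by (subst le_mod_geq) auto
      finally show ?thesis using lt False by linarith
    qed
    finally show ?thesis using digits True by (simp add: d_def)
  qed
qed

lemma base_digit_eq_leading_iff:
  assumes "t < p ^ Suc s"
  shows "t = base_digit p t s * p ^ s \<longleftrightarrow> p ^ s dvd t"
proof -
  have "t div p ^ s < p" using assms by (simp add: less_mult_imp_div_less)
  hence "base_digit p t s = t div p ^ s" by (simp add: base_digit_def)
  thus ?thesis by (metis dvd_div_mult_self dvd_triv_right)
qed

text \<open>Divisibility by \<open>p ^ m\<close> means that the digits below \<open>m\<close>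
  vanish. If \<open>m\<close> exceeds \<open>base_top p k\<close>, the sum is empty and both sides
  say \<open>k = 0\<close>.\<close>

lemma sum_high_base_digits_eq_iff:
  assumes "p \<ge> 2"
  shows "k = (\<Sum>i = m..base_top p k. base_digit p k i * p ^ i) \<longleftrightarrow> p ^ m dvd k"
proof
  assume "k = (\<Sum>i = m..base_top p k. base_digit p k i * p ^ i)"
  moreover have "p ^ m dvd (\<Sum>i = m..base_top p k. base_digit p k i * p ^ i)"
    by (intro dvd_sum dvd_mult) (auto intro: le_imp_power_dvd)
  ultimately show "p ^ m dvd k" by simp
next
  assume "p ^ m dvd k"
  hence "\<forall>i<m. base_digit p k i = base_digit p 0 i"
    using assms by (subst mod_power_eq_iff_base_digit[symmetric]) auto
  hence zero: "base_digit p k i = 0" if "i < m" for i using that by (simp add: base_digit_def)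
  have "k = (\<Sum>i\<le>base_top p k. base_digit p k i * p ^ i)" by (rule base_expansion[OF assms])
  also have "\<dots> = (\<Sum>i = m..base_top p k. base_digit p k i * p ^ i)"
    by (rule sum.mono_neutral_right) (auto simp: zero)
  finally show "k = (\<Sum>i = m..base_top p k. base_digit p k i * p ^ i)" .
qed

lemma choose_not_dvd_iff_base_digits:
  fixes p k t :: nat
  assumes p: "prime p" and t: "t \<le> k"
  shows "(\<forall>i\<le>t. \<not> p dvd (k - i) choose (t - i)) \<longleftrightarrow>
    (\<forall>j<base_top p t. base_digit p k j = base_digit p t j)
      \<and> base_digit p t (base_top p t) \<le> base_digit p k (base_top p t)"
proof (cases "t = 0")
  \<comment> \<open>No power of \<open>p\<close> is at most \<open>t = 0\<close>, so the valuation
    lemma does not apply; both sides hold trivially, the right one by the convention for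
    \<open>base_top\<close>.\<close>
  case True
  thus ?thesis using p by (auto simp: base_top_def base_digit_def)
next
  case False
  note p2 = prime_ge_2_nat[OF p]
  have "(\<forall>i\<le>t. \<not> p dvd (k - i) choose (t - i)) \<longleftrightarrow> (\<forall>j\<le>t. \<not> p dvd (k - t + j) choose j)"
    using t by (metis (no_types, lifting) Nat.add_diff_assoc2 diff_diff_cancel diff_le_self le_add_diff_inverse2 Nat.diff_diff_right)
  also have "\<dots> \<longleftrightarrow> (\<forall>i. 0 < i \<and> i \<le> t \<longrightarrow> multiplicity p (k - t + i) = multiplicity p i)"
    by (rule choose_not_dvd_iff[OF p])
  also have "\<dots> \<longleftrightarrow> p ^ base_top p t dvd k - t
      \<and> (k - t) mod p ^ Suc (base_top p t) + t < p ^ Suc (base_top p t)"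
    by (rule multiplicity_shift_iff[OF p power_base_top_le[OF p2 False] less_power_Suc_base_top[OF p2]])
  also note base_digits_condition_iff[OF prime_gt_0_nat[OF p] less_power_Suc_base_top[OF p2] t, symmetric]
  finally show ?thesis .
qed

text \<open>Under \<open>j = t - i\<close> the coefficient with \<open>i = 0\<close> is the last of
  the chain \<open>(d + j) choose j\<close>. It is the only one divisible by \<open>p\<close> iff
  the valuations of \<open>d + j\<close> and \<open>j\<close> first differ at
  \<open>j = t\<close>.\<close>

lemma only_choose_dvd_iff_base_digits:
  fixes p k t :: nat
  assumes p: "prime p" and t: "0 < t" "t \<le> k"
  shows "p dvd k choose t \<and> (\<forall>i\<in>{1..t}. \<not> p dvd (k - i) choose (t - i)) \<longleftrightarrow>
    t = base_digit p t (base_top p t) * p ^ base_top p t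
      \<and> k = (\<Sum>i = base_top p t + 1..base_top p k. base_digit p k i * p ^ i)"
proof -
  note p2 = prime_ge_2_nat[OF p]
  define d where "d = k - t"
  have k: "k = d + t" using t by (simp add: d_def)
  obtain u where u: "t = Suc u" using t gr0_implies_Suc by blast
  have reindex: "(\<forall>i\<in>{1..t}. \<not> p dvd (k - i) choose (t - i)) \<longleftrightarrow> (\<forall>j\<le>u. \<not> p dvd (d + j) choose j)"
  proof safe
    fix j assume *: "\<forall>i\<in>{1..t}. \<not> p dvd (k - i) choose (t - i)" and "j \<le> u" "p dvd (d + j) choose j"
    hence "t - j \<in> {1..t}" "k - (t - j) = d + j" "t - (t - j) = j" using u k by auto
    with * \<open>p dvd (d + j) choose j\<close> show False by metis
  next
    fix i assume *: "\<forall>j\<le>u. \<not> p dvd (d + j) choose j" and "i \<in> {1..t}" "p dvd (k - i) choose (t - i)"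
    hence "t - i \<le> u" "d + (t - i) = k - i" using u k by auto
    with * \<open>p dvd (k - i) choose (t - i)\<close> show False by metis
  qed
  have "p dvd k choose t \<and> (\<forall>j\<le>u. \<not> p dvd (d + j) choose j) \<longleftrightarrow>
      \<not> (\<forall>j\<le>t. \<not> p dvd (d + j) choose j) \<and> (\<forall>j\<le>u. \<not> p dvd (d + j) choose j)"
    unfolding k u le_Suc_eq by auto
  also have "\<dots> \<longleftrightarrow> (\<forall>i. 0 < i \<and> i < t \<longrightarrow> multiplicity p (d + i) = multiplicity p i)
      \<and> multiplicity p (d + t) \<noteq> multiplicity p t"
    unfolding choose_not_dvd_iff[OF p] unfolding u less_Suc_eq_le le_Suc_eq[of _ u] by auto
  also have "\<dots> \<longleftrightarrow> p ^ base_top p t dvd t \<and> p ^ Suc (base_top p t) dvd d + t"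
    using t by (intro first_multiplicity_change_iff[OF p] power_base_top_le[OF p2] less_power_Suc_base_top[OF p2]) simp
  also have "\<dots> \<longleftrightarrow> t = base_digit p t (base_top p t) * p ^ base_top p t
      \<and> k = (\<Sum>i = base_top p t + 1..base_top p k. base_digit p k i * p ^ i)"
    unfolding sum_high_base_digits_eq_iff[OF p2] base_digit_eq_leading_iff[OF less_power_Suc_base_top[OF p2]]
    using k by simp
  finally show ?thesis using reindex by simp
qed

section \<open>Functions on \<open>t\<close>-subsets with vanishing sums\<close>

lemma mem_subsets_of_card: "T \<in> subsets_of_card V t \<longleftrightarrow> T \<subseteq> V \<and> card T = t"
  by (simp add: subsets_of_card_def)

lemma finite_subsets_of_card: "finite V \<Longrightarrow> finite (subsets_of_card V t)"
  by (simp add: subsets_of_card_def)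

lemma sum_subsets_of_card_insert:
  fixes f :: "'a set \<Rightarrow> 'b::comm_monoid_add"
  assumes "finite V" "x \<notin> V"
  shows "(\<Sum>T\<in>subsets_of_card (insert x V) (Suc t). f T) =
    (\<Sum>T\<in>subsets_of_card V (Suc t). f T) + (\<Sum>T\<in>subsets_of_card V t. f (insert x T))"
proof -
  have split: "subsets_of_card (insert x V) (Suc t) =
      subsets_of_card V (Suc t) \<union> insert x ` subsets_of_card V t"
  proof (intro equalityI subsetI)
    fix T assume T: "T \<in> subsets_of_card (insert x V) (Suc t)"
    show "T \<in> subsets_of_card V (Suc t) \<union> insert x ` subsets_of_card V t"
    proof (cases "x \<in> T")
      case True
      hence "T - {x} \<in> subsets_of_card V t" "T = insert x (T - {x})"
        using T assms by (auto simp: mem_subsets_of_card)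
      thus ?thesis by blast
    qed (use T in \<open>auto simp: mem_subsets_of_card\<close>)
  next
    fix T assume "T \<in> subsets_of_card V (Suc t) \<union> insert x ` subsets_of_card V t"
    thus "T \<in> subsets_of_card (insert x V) (Suc t)"
    proof
      assume "T \<in> insert x ` subsets_of_card V t"
      then obtain S where S: "T = insert x S" "S \<subseteq> V" "card S = t"
        by (auto simp: mem_subsets_of_card)
      moreover have "finite S" "x \<notin> S" using S assms finite_subset by auto
      ultimately show ?thesis by (auto simp: mem_subsets_of_card)
    qed (auto simp: mem_subsets_of_card)
  qed
  have "inj_on (insert x) (subsets_of_card V t)"
  proof (rule inj_onI)
    fix S T assume "S \<in> subsets_of_card V t" "T \<in> subsets_of_card V t" "insert x S = insert x T"
    moreover from this have "x \<notin> S" "x \<notin> T" using assms(2) by (auto simp: mem_subsets_of_card)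
    ultimately show "S = T" by (simp add: insert_ident)
  qed
  moreover have "subsets_of_card V (Suc t) \<inter> insert x ` subsets_of_card V t = {}"
    using assms(2) by (auto simp: mem_subsets_of_card)
  ultimately show ?thesis
    using assms(1) unfolding split
    by (subst sum.union_disjoint) (auto simp: finite_subsets_of_card sum.reindex)
qed

definition null_on_subsets :: "'a set \<Rightarrow> nat \<Rightarrow> nat \<Rightarrow> ('a set \<Rightarrow> 'b::comm_monoid_add) \<Rightarrow> bool" where
  "null_on_subsets V t k f \<longleftrightarrow> (\<forall>K\<in>subsets_of_card V k. (\<Sum>T\<in>subsets_of_card K t. f T) = 0)"

lemma ex_subset_of_card: "k \<le> card V \<Longrightarrow> \<exists>K. K \<in> subsets_of_card V k"
  by (metis mem_subsets_of_card obtain_subset_with_card_n)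

text \<open>Each sum has \<open>k choose t\<close> equal terms. The bound on \<open>k\<close>
  provides a \<open>k\<close>-subset, without which nullness would be vacuous.\<close>

lemma null_on_subsets_const_iff:
  fixes c :: "'b::idom"
  assumes "finite V" "k \<le> card V" "\<And>T. T \<in> subsets_of_card V t \<Longrightarrow> f T = c"
  shows "null_on_subsets V t k f \<longleftrightarrow> of_nat (k choose t) * c = 0"
proof -
  have "(\<Sum>T\<in>subsets_of_card K t. f T) = of_nat (k choose t) * c" if "K \<in> subsets_of_card V k" for K
  proof -
    have K: "K \<subseteq> V" "finite K" "card K = k"
      using that assms(1) finite_subset by (auto simp: mem_subsets_of_card)
    have "(\<Sum>T\<in>subsets_of_card K t. f T) = (\<Sum>T\<in>subsets_of_card K t. c)"
      using K assms(3) by (intro sum.cong) (auto simp: mem_subsets_of_card)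
    thus ?thesis using K by (simp add: card_subsets_of_card)
  qed
  thus ?thesis using ex_subset_of_card[OF assms(2)] by (auto simp: null_on_subsets_def)
qed

text \<open>Compare the vanishing sums over \<open>insert x K\<close> and \<open>insert y K\<close>:
  the terms from subsets of \<open>K\<close> itself cancel.\<close>

lemma null_on_subsets_diff:
  fixes f :: "'a set \<Rightarrow> 'b::ab_group_add"
  assumes "finite V" "null_on_subsets V (Suc t) (Suc k) f" "x \<in> V" "y \<in> V"
  shows "null_on_subsets (V - {x, y}) t k (\<lambda>T. f (insert x T) - f (insert y T))"
  unfolding null_on_subsets_def
proof
  fix K assume K: "K \<in> subsets_of_card (V - {x, y}) k"
  hence fin: "finite K" using assms(1) by (auto simp: mem_subsets_of_card intro: finite_subset)
  have "(\<Sum>T\<in>subsets_of_card K (Suc t). f T) + (\<Sum>T\<in>subsets_of_card K t. f (insert z T)) = 0"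
    if "z \<in> {x, y}" for z
  proof -
    have "z \<notin> K" "insert z K \<in> subsets_of_card V (Suc k)"
      using K that assms fin by (auto simp: mem_subsets_of_card card_insert_if)
    thus ?thesis using assms(2) sum_subsets_of_card_insert[OF fin, of z f t]
      by (simp add: null_on_subsets_def)
  qed
  from this[of x] this[of y]
  have "(\<Sum>T\<in>subsets_of_card K t. f (insert x T)) = (\<Sum>T\<in>subsets_of_card K t. f (insert y T))"
    by (simp add: add_eq_0_iff)
  thus "(\<Sum>T\<in>subsets_of_card K t. f (insert x T) - f (insert y T)) = 0"
    by (simp add: sum_subtractf)
qed

text \<open>Any two subsets of equal size are joined by single exchanges: swapping an
  \<open>x\<close> in \<open>S - T\<close> for a \<open>y\<close> in \<open>T - S\<close> shrinks
  \<open>S - T\<close>.\<close>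

lemma eq_on_subsets_of_card_by_exchange:
  assumes "finite V"
    and exchange: "\<And>x y T. \<lbrakk>x \<in> V; y \<in> V; x \<noteq> y; T \<in> subsets_of_card (V - {x, y}) t\<rbrakk>
      \<Longrightarrow> f (insert x T) = f (insert y T)"
    and "S \<in> subsets_of_card V (Suc t)" "T \<in> subsets_of_card V (Suc t)"
  shows "f S = f T"
  using assms(3)
proof (induction "card (S - T)" arbitrary: S rule: less_induct)
  case less
  have S: "S \<subseteq> V" "card S = Suc t" "finite S" and T: "T \<subseteq> V" "card T = Suc t" "finite T"
    using less.prems assms(1,4) finite_subset by (auto simp: mem_subsets_of_card)
  show ?case
  proof (cases "S = T")
    case False
    have "\<not> S \<subseteq> T" "\<not> T \<subseteq> S" using False S T by (metis card_subset_eq)+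
    then obtain x y where x: "x \<in> S" "x \<notin> T" and y: "y \<in> T" "y \<notin> S" by blast
    define R where "R = S - {x}"
    have R: "R \<in> subsets_of_card (V - {x, y}) t" "S = insert x R"
      using S x y by (auto simp: R_def mem_subsets_of_card)
    have "f S = f (insert y R)"
      unfolding R(2) using R(1) S T x y by (intro exchange) auto
    also have "\<dots> = f T"
    proof (rule less.hyps)
      have "insert y R - T = (S - T) - {x}" using y by (auto simp: R_def)
      moreover have "x \<in> S - T" "finite (S - T)" using x S by auto
      ultimately show "card (insert y R - T) < card (S - T)"
        by (metis card_Diff1_less)
      have "card (insert y R) = Suc t" using S x y by (simp add: R_def)
      thus "insert y R \<in> subsets_of_card V (Suc t)"
        using S T y by (auto simp: R_def mem_subsets_of_card)
    qed
    finally show ?thesis .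
  qed simp
qed

text \<open>The range of \<open>i\<close> starts at 1 because \<open>k choose t\<close> only decides
  whether nonzero constants are null, not whether null functions are constant.\<close>

lemma null_on_subsets_imp_const:
  fixes f :: "'a set \<Rightarrow> 'b::idom"
  assumes "finite V" "t \<le> k" "t + k \<le> card V"
    and "\<And>i. i \<in> {1..t} \<Longrightarrow> of_nat ((k - i) choose (t - i)) \<noteq> (0::'b)"
    and "null_on_subsets V t k f"
  shows "\<exists>c. \<forall>T\<in>subsets_of_card V t. f T = c"
  using assms
proof (induction t arbitrary: V k f)
  case 0
  have "subsets_of_card V 0 = {{}}"
    using 0(1) by (auto simp: mem_subsets_of_card finite_subset)
  thus ?case by simp
next
  case (Suc t)
  then obtain l where k: "k = Suc l" by (cases k) auto
  have "f (insert x T) = f (insert y T)"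
    if "x \<in> V" "y \<in> V" "x \<noteq> y" and T: "T \<in> subsets_of_card (V - {x, y}) t" for x y T
  proof -
    let ?V = "V - {x, y}" and ?g = "\<lambda>T. f (insert x T) - f (insert y T)"
    \<comment> \<open>Deleting two points and lowering both parameters by one preserves the size
      bound.\<close>
    have fin: "finite ?V" and card: "t + l \<le> card ?V"
      using Suc.prems(1,3) that k by (auto simp: card_Diff_subset)
    have null: "null_on_subsets ?V t l ?g"
      using Suc.prems(1,5) that unfolding k by (intro null_on_subsets_diff)
    have nz: "of_nat ((l - i) choose (t - i)) \<noteq> (0::'b)" if "i \<le> t" for i
      using Suc.prems(4)[of "Suc i"] that k by simp
    have "\<exists>c. \<forall>T\<in>subsets_of_card ?V t. ?g T = c"
      using Suc.prems(2) k nz by (intro Suc.IH[OF fin _ card _ null]) auto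
    then obtain c where c: "\<And>T. T \<in> subsets_of_card ?V t \<Longrightarrow> ?g T = c" by blast
    \<comment> \<open>The constant difference is itself null, and \<open>l choose t\<close> is the
      coefficient with \<open>i = 1\<close>, hence nonzero; so \<open>c = 0\<close>.\<close>
    have "of_nat (l choose t) * c = 0"
      using null_on_subsets_const_iff[OF fin _ c] null card by auto
    thus ?thesis using nz[of 0] c[OF T] by simp
  qed
  hence "f S = f T" if "S \<in> subsets_of_card V (Suc t)" "T \<in> subsets_of_card V (Suc t)" for S T
    using eq_on_subsets_of_card_by_exchange[OF Suc.prems(1) _ that] by blast
  thus ?case by blast
qed

text \<open>The sum over \<open>K\<close> counts the sets \<open>T\<close> between \<open>I\<close>
  and \<open>K\<close>. There are none unless \<open>I\<close> lies in \<open>K\<close>, and then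
  removing \<open>I\<close> matches them with the \<open>(t - i)\<close>-subsets of
  \<open>K - I\<close>.\<close>

lemma null_on_subsets_superset_indicator:
  assumes "finite V" "i \<le> t" "t \<le> k" "of_nat ((k - i) choose (t - i)) = (0::'b::semiring_1)"
    and I: "card I = i"
  shows "null_on_subsets V t k (\<lambda>T. if I \<subseteq> T then 1 else (0::'b))"
  unfolding null_on_subsets_def
proof
  fix K assume "K \<in> subsets_of_card V k"
  hence K: "finite K" "card K = k" using assms(1) finite_subset by (auto simp: mem_subsets_of_card)
  have "(\<Sum>T\<in>subsets_of_card K t. if I \<subseteq> T then 1 else (0::'b)) =
      (\<Sum>T | T \<in> subsets_of_card K t \<and> I \<subseteq> T. 1)"
    using K by (intro sum.inter_filter[symmetric] finite_subsets_of_card)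
  also have "\<dots> = of_nat (card {T \<in> subsets_of_card K t. I \<subseteq> T})"
    by (simp only: sum_constant mult_1_right)
  also have "\<dots> = 0"
  proof (cases "I \<subseteq> K")
    case False
    hence "{T \<in> subsets_of_card K t. I \<subseteq> T} = {}" by (auto simp: mem_subsets_of_card)
    thus ?thesis by (simp only: card.empty of_nat_0)
  next
    case True
    hence fin: "finite I" using K finite_subset by blast
    have "bij_betw (\<lambda>T. T - I) {T \<in> subsets_of_card K t. I \<subseteq> T} (subsets_of_card (K - I) (t - i))"
    proof (rule bij_betw_byWitness[where f' = "\<lambda>T. T \<union> I"])
      show "(\<lambda>T. T \<union> I) ` subsets_of_card (K - I) (t - i) \<subseteq> {T \<in> subsets_of_card K t. I \<subseteq> T}"
      proof (clarsimp simp: mem_subsets_of_card True)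
        fix T assume T: "T \<subseteq> K - I" "card T = t - i"
        hence "finite T" "T \<inter> I = {}" using K finite_subset by blast+
        thus "T \<subseteq> K \<and> card (T \<union> I) = t"
          using T fin I assms(2) by (auto simp: card_Un_disjoint)
      qed
    qed (use fin I in \<open>auto simp: mem_subsets_of_card card_Diff_subset\<close>)
    hence "card {T \<in> subsets_of_card K t. I \<subseteq> T} = card (subsets_of_card (K - I) (t - i))"
      by (rule bij_betw_same_card)
    also have "\<dots> = (k - i) choose (t - i)"
      using True K fin I by (simp add: card_subsets_of_card card_Diff_subset)
    finally show ?thesis using assms(4) by simp
  qed
  finally show "(\<Sum>T\<in>subsets_of_card K t. if I \<subseteq> T then 1 else (0::'b)) = 0" .
qed

text \<open>A vanishing coefficient yields a null indicator with value 1 at any \<open>T\<close>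
  containing \<open>I\<close>. Otherwise null functions are constant, and the coefficient with
  \<open>i = 0\<close> makes the constant 0.\<close>

lemma null_on_subsets_trivial_iff:
  assumes "finite V" "t \<le> k" "t + k \<le> card V"
  shows "(\<forall>f::'a set \<Rightarrow> 'b::idom. null_on_subsets V t k f \<longrightarrow> (\<forall>T\<in>subsets_of_card V t. f T = 0)) \<longleftrightarrow>
    (\<forall>i\<le>t. of_nat ((k - i) choose (t - i)) \<noteq> (0::'b))"
proof (intro iffI allI impI)
  fix i assume triv: "\<forall>f::'a set \<Rightarrow> 'b. null_on_subsets V t k f \<longrightarrow> (\<forall>T\<in>subsets_of_card V t. f T = 0)"
    and i: "i \<le> t"
  show "of_nat ((k - i) choose (t - i)) \<noteq> (0::'b)"
  proof
    assume zero: "of_nat ((k - i) choose (t - i)) = (0::'b)"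
    obtain T where T: "T \<in> subsets_of_card V t" using ex_subset_of_card[of t V] assms by auto
    obtain I where I: "I \<subseteq> T" "card I = i"
      using ex_subset_of_card[of i T] i T by (auto simp: mem_subsets_of_card)
    show False
      using triv null_on_subsets_superset_indicator[OF assms(1) i assms(2) zero I(2)] I T by fastforce
  qed
next
  fix f :: "'a set \<Rightarrow> 'b"
  assume nz: "\<forall>i\<le>t. of_nat ((k - i) choose (t - i)) \<noteq> (0::'b)" and null: "null_on_subsets V t k f"
  obtain c where c: "\<And>T. T \<in> subsets_of_card V t \<Longrightarrow> f T = c"
    using null_on_subsets_imp_const[OF assms _ null] nz by auto
  have "of_nat (k choose t) * c = 0"
    using null_on_subsets_const_iff[OF assms(1) _ c] null assms(3) by auto
  moreover have "of_nat (k choose t) \<noteq> (0::'b)" using nz by (metis diff_zero le0)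
  ultimately show "\<forall>T\<in>subsets_of_card V t. f T = 0" using c by simp
qed

lemma null_on_subsets_iff_const_iff:
  assumes "finite V" "0 < t" "t \<le> k" "t + k \<le> card V"
  shows "(\<forall>f::'a set \<Rightarrow> 'b::idom. null_on_subsets V t k f \<longleftrightarrow> (\<exists>c. \<forall>T\<in>subsets_of_card V t. f T = c)) \<longleftrightarrow>
    of_nat (k choose t) = (0::'b) \<and> (\<forall>i\<in>{1..t}. of_nat ((k - i) choose (t - i)) \<noteq> (0::'b))"
proof (rule iffI; intro conjI ballI allI)
  assume const: "\<forall>f::'a set \<Rightarrow> 'b. null_on_subsets V t k f \<longleftrightarrow> (\<exists>c. \<forall>T\<in>subsets_of_card V t. f T = c)"
  have "null_on_subsets V t k (\<lambda>_. 1::'b)" using const by auto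
  thus "of_nat (k choose t) = (0::'b)"
    using null_on_subsets_const_iff[of V k t "\<lambda>_. 1::'b" 1] assms by auto
  fix i assume i: "i \<in> {1..t}"
  show "of_nat ((k - i) choose (t - i)) \<noteq> (0::'b)"
  proof
    assume zero: "of_nat ((k - i) choose (t - i)) = (0::'b)"
    obtain T where T: "T \<in> subsets_of_card V t" using ex_subset_of_card[of t V] assms by auto
    obtain I where I: "I \<subseteq> T" "card I = i"
      using ex_subset_of_card[of i T] i T by (auto simp: mem_subsets_of_card)
    then obtain x where x: "x \<in> I" using i by fastforce
    \<comment> \<open>There is room for a \<open>t\<close>-subset \<open>S\<close> avoiding a point
      of \<open>I\<close>. The indicator is 0 at \<open>S\<close> and 1 at \<open>T\<close>, so it
      is not constant.\<close>
    have "t \<le> card (V - {x})" using assms I T x by (subst card_Diff_singleton) (auto simp: mem_subsets_of_card)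
    then obtain S where S: "S \<in> subsets_of_card (V - {x}) t" using ex_subset_of_card by blast
    have "i \<le> t" using i by simp
    from null_on_subsets_superset_indicator[OF assms(1) this assms(3) zero I(2)]
    have "\<exists>c. \<forall>T\<in>subsets_of_card V t. (if I \<subseteq> T then 1 else (0::'b)) = c"
      using const[rule_format, of "\<lambda>T. if I \<subseteq> T then 1 else 0"] by simp
    then obtain c where "\<And>T. T \<in> subsets_of_card V t \<Longrightarrow> (if I \<subseteq> T then 1 else (0::'b)) = c"
      by blast
    moreover have "S \<in> subsets_of_card V t" "\<not> I \<subseteq> S" using S x by (auto simp: mem_subsets_of_card)
    ultimately show False using T I by (metis zero_neq_one)
  qed
next
  fix f :: "'a set \<Rightarrow> 'b"
  assume *: "of_nat (k choose t) = (0::'b) \<and> (\<forall>i\<in>{1..t}. of_nat ((k - i) choose (t - i)) \<noteq> (0::'b))"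
  show "null_on_subsets V t k f \<longleftrightarrow> (\<exists>c. \<forall>T\<in>subsets_of_card V t. f T = c)"
  proof
    assume "null_on_subsets V t k f"
    thus "\<exists>c. \<forall>T\<in>subsets_of_card V t. f T = c"
      using null_on_subsets_imp_const[OF assms(1,3,4)] * by blast
  next
    assume "\<exists>c. \<forall>T\<in>subsets_of_card V t. f T = c"
    then obtain c where c: "\<And>T. T \<in> subsets_of_card V t \<Longrightarrow> f T = c" by blast
    show "null_on_subsets V t k f"
      using null_on_subsets_const_iff[OF assms(1) _ c] assms(4) * by auto
  qed
qed

section \<open>The kernel of the transposed inclusion matrix\<close>

text \<open>Reduces the basis claim to an equation of sets; the equation also puts \<open>u\<close>
  into the kernel, as \<open>u\<close> is its own multiple by 1.\<close>

lemma (in kernel) basis_singleton_iff: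
  "basis {u} \<longleftrightarrow> u \<noteq> 0\<^sub>v nc \<and> mat_kernel A = range (\<lambda>c. c \<cdot>\<^sub>v u)"
proof -
  have "span {u} = range (\<lambda>c. c \<cdot>\<^sub>v u)" and "lin_indpt {u} \<longleftrightarrow> u \<noteq> 0\<^sub>v nc" if u: "u \<in> mat_kernel A"
  proof -
    have u': "u \<in> carrier_vec nc" using u mat_kernel_carrier[OF A] by blast
    have lc: "lincomb a {u} = a u \<cdot>\<^sub>v u" for a
      using u u' by (simp add: lincomb_same NC.lincomb_def)
    show "span {u} = range (\<lambda>c. c \<cdot>\<^sub>v u)"
      using u by (subst Ker.finite_span) (auto simp: lc)
    show "lin_indpt {u} \<longleftrightarrow> u \<noteq> 0\<^sub>v nc"
    proof
      have "lin_dep {u}" if "u = 0\<^sub>v nc"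
        unfolding Ker.lin_dep_def using that lc[of "\<lambda>_. 1"]
        by (intro exI[of _ "{u}"] exI[of _ "\<lambda>_. 1"] exI[of _ u]) auto
      thus "lin_indpt {u} \<Longrightarrow> u \<noteq> 0\<^sub>v nc" by blast
    next
      assume u0: "u \<noteq> 0\<^sub>v nc"
      have "c = 0" if "c \<cdot>\<^sub>v u = 0\<^sub>v nc" for c
        using that u0 u' by (auto simp: vec_eq_iff)
      thus "lin_indpt {u}"
        unfolding Ker.lin_dep_def using lc by (auto simp: subset_singleton_iff)
    qed
  qed
  moreover have "u \<in> range (\<lambda>c. c \<cdot>\<^sub>v u)" by (metis one_smult_vec rangeI)
  ultimately show ?thesis unfolding Ker.basis_def by auto
qed

lemma (in kernel) dim_eq_1_if_basis_singleton:
  "basis {u} \<Longrightarrow> dim = 1"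
  using Ker.dim_basis[of "{u}"] by simp

text \<open>Entry \<open>j\<close> of the matrix-vector product is the sum of \<open>f\<close> over
  the \<open>t\<close>-subsets of \<open>cs j\<close>, and \<open>cs\<close> runs through all
  \<open>k\<close>-subsets.\<close>

lemma vec_mem_mat_kernel_transpose_inclusion_iff:
  fixes f :: "'a set \<Rightarrow> 'b::comm_ring_1"
  assumes "finite V" "enumerates rs (subsets_of_card V t)" "enumerates cs (subsets_of_card V k)"
  shows "vec (card V choose t) (\<lambda>i. f (rs i)) \<in> mat_kernel (transpose_mat (inclusion_mat V t k rs cs))
    \<longleftrightarrow> null_on_subsets V t k f"
proof -
  have rs: "bij_betw rs {..<card V choose t} (subsets_of_card V t)"
    and cs: "bij_betw cs {..<card V choose k} (subsets_of_card V k)"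
    using assms by (simp_all add: enumerates_def card_subsets_of_card)
  define W where "W = transpose_mat (inclusion_mat V t k rs cs :: 'b mat)"
  define x where "x = vec (card V choose t) (\<lambda>i. f (rs i))"
  have dim: "dim_row W = card V choose k" "dim_col W = card V choose t" "dim_vec x = card V choose t"
    by (simp_all add: W_def x_def inclusion_mat_def)
  have entry: "(W *\<^sub>v x) $ j = (\<Sum>T\<in>subsets_of_card (cs j) t. f T)" if j: "j < card V choose k" for j
  proof -
    have cj: "cs j \<subseteq> V" using bij_betwE[OF cs] j by (auto simp: mem_subsets_of_card)
    have "(W *\<^sub>v x) $ j = (\<Sum>i<card V choose t. (if rs i \<subseteq> cs j then 1 else 0) * f (rs i))"
      using j by (simp add: W_def x_def scalar_prod_def inclusion_mat_def atLeast0LessThan)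
    also have "\<dots> = (\<Sum>T\<in>subsets_of_card V t. (if T \<subseteq> cs j then 1 else 0) * f T)"
      by (rule sum.reindex_bij_betw[OF rs])
    also have "\<dots> = (\<Sum>T\<in>subsets_of_card (cs j) t. f T)"
    proof (rule sum.mono_neutral_cong_right)
      show "subsets_of_card (cs j) t \<subseteq> subsets_of_card V t"
        using cj unfolding subsets_of_card_def by blast
    qed (use assms(1) in \<open>auto simp: mem_subsets_of_card finite_subsets_of_card\<close>)
    finally show ?thesis .
  qed
  have "W \<in> carrier_mat (card V choose k) (card V choose t)" "x \<in> carrier_vec (card V choose t)"
    using dim by (intro carrier_matI carrier_vecI; simp)+
  hence "x \<in> mat_kernel W \<longleftrightarrow> W *\<^sub>v x = 0\<^sub>v (card V choose k)"
    by (simp only: mat_kernel mem_Collect_eq simp_thms)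
  also have "\<dots> \<longleftrightarrow> (\<forall>j<card V choose k. (W *\<^sub>v x) $ j = 0)"
    unfolding vec_eq_iff dim_mult_mat_vec index_zero_vec(2) dim(1) by (metis index_zero_vec(1))
  also have "\<dots> \<longleftrightarrow> (\<forall>j\<in>{..<card V choose k}. (\<Sum>T\<in>subsets_of_card (cs j) t. f T) = 0)"
    by (auto simp: entry)
  also have "\<dots> \<longleftrightarrow> null_on_subsets V t k f"
    unfolding null_on_subsets_def bij_betw_imp_surj_on[OF cs, symmetric] by blast
  finally show ?thesis unfolding W_def x_def .
qed

lemma ex_vec_of_enumeration:
  assumes "inj_on rs {..<n}" "x \<in> carrier_vec n"
  shows "\<exists>f. x = vec n (\<lambda>i. f (rs i))"
  using assms by (intro exI[of _ "\<lambda>T. x $ the_inv_into {..<n} rs T"]) (auto simp: the_inv_into_f_f)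

lemma of_nat_mod_ring_eq_0_iff:
  "of_nat n = (0 :: 'p::prime_card mod_ring) \<longleftrightarrow> CARD('p) dvd n"
proof
  assume "CARD('p) dvd n"
  then obtain m where "n = CARD('p) * m" by blast
  thus "of_nat n = (0 :: 'p mod_ring)" by simp
qed (rule of_nat_0_mod_ring_dvd)

text \<open>The second part excludes \<open>t = 0\<close>: there the transposed matrix is a column
  of ones with zero kernel, although the digit conditions hold whenever \<open>p\<close> divides
  \<open>k\<close>.\<close>

theorem theorem2p6:
  fixes p v t k :: nat
    and V :: "'a set"
    and rs cs :: "nat \<Rightarrow> 'a set"
    and W :: "'p::prime_card mod_ring mat"
  assumes "prime p" and "CARD('p) = p"
    and "k \<le> v" and "t \<le> min k (v - k)"
    and "finite V" and "card V = v"
    and "enumerates rs (subsets_of_card V t)"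
    and "enumerates cs (subsets_of_card V k)"
    and "W = inclusion_mat V t k rs cs"
  shows "((\<forall>j < base_top p t. base_digit p k j = base_digit p t j)
            \<and> base_digit p k (base_top p t) \<ge> base_digit p t (base_top p t)
          \<longleftrightarrow> mat_kernel (transpose_mat W) = {0\<^sub>v (v choose t)})
       \<and> (t > 0 \<longrightarrow>
          (t = base_digit p t (base_top p t) * p ^ base_top p t
            \<and> k = (\<Sum>i = base_top p t + 1..base_top p k. base_digit p k i * p ^ i)
          \<longleftrightarrow> kernel_dim (transpose_mat W) = 1
            \<and> kernel.basis (v choose t) (transpose_mat W) {vec (v choose t) (\<lambda>_. 1)}))"
proof -
  let ?n = "v choose t" and ?M = "mat_kernel (transpose_mat W)"
  have tk: "t \<le> k" "t + k \<le> card V" using assms(3,4,6) by auto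
  have rs: "bij_betw rs {..<?n} (subsets_of_card V t)"
    using assms(5-7) by (simp add: enumerates_def card_subsets_of_card)
  hence "subsets_of_card V t = rs ` {..<?n}" by (simp add: bij_betw_imp_surj_on)
  hence ball_rs: "(\<forall>i<?n. P (rs i)) \<longleftrightarrow> (\<forall>T\<in>subsets_of_card V t. P T)" for P
    by auto
  have mem: "vec ?n (\<lambda>i. f (rs i)) \<in> ?M \<longleftrightarrow> null_on_subsets V t k f" for f
    using vec_mem_mat_kernel_transpose_inclusion_iff[OF assms(5,7,8)] assms(6,9) by simp
  have W: "transpose_mat W \<in> carrier_mat (v choose k) ?n"
    using assms(6,9) by (simp add: inclusion_mat_def)
  \<comment> \<open>Every vector of length \<open>?n\<close> comes from some \<open>f\<close>, so
    equality of the kernel with a set of such vectors can be tested on functions.\<close>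
  have subset_iff: "?M = X \<longleftrightarrow> (\<forall>f. null_on_subsets V t k f \<longleftrightarrow> vec ?n (\<lambda>i. f (rs i)) \<in> X)"
    if "X \<subseteq> carrier_vec ?n" for X
  proof
    assume R: "\<forall>f. null_on_subsets V t k f \<longleftrightarrow> vec ?n (\<lambda>i. f (rs i)) \<in> X"
    have "x \<in> ?M \<longleftrightarrow> x \<in> X" if x: "x \<in> carrier_vec ?n" for x
    proof -
      obtain f where "x = vec ?n (\<lambda>i. f (rs i))"
        using ex_vec_of_enumeration[OF _ x] rs by (auto simp: bij_betw_def)
      thus ?thesis using mem[of f] R by simp
    qed
    thus "?M = X" using mat_kernel_carrier[OF W] that by blast
  qed (simp add: mem[symmetric])
  have zero: "of_nat m = (0::'p mod_ring) \<longleftrightarrow> p dvd m" for m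
    using of_nat_mod_ring_eq_0_iff assms(2) by auto

  have "?M = {0\<^sub>v ?n} \<longleftrightarrow> (\<forall>f. null_on_subsets V t k f \<longleftrightarrow> (\<forall>T\<in>subsets_of_card V t. f T = (0::'p mod_ring)))"
    by (subst subset_iff) (auto simp: vec_eq_iff ball_rs[symmetric])
  \<comment> \<open>Functions vanishing on all \<open>t\<close>-subsets are always null, so one
    implication suffices.\<close>
  also have "\<dots> \<longleftrightarrow> (\<forall>f. null_on_subsets V t k f \<longrightarrow> (\<forall>T\<in>subsets_of_card V t. f T = (0::'p mod_ring)))"
    using null_on_subsets_const_iff[OF assms(5), of k t _ "0::'p mod_ring"] tk by auto
  also have "\<dots> \<longleftrightarrow> (\<forall>i\<le>t. \<not> p dvd (k - i) choose (t - i))"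
    using null_on_subsets_trivial_iff[OF assms(5) tk, where 'b = "'p mod_ring"] by (simp add: zero)
  finally have part1: "?M = {0\<^sub>v ?n} \<longleftrightarrow> (\<forall>i\<le>t. \<not> p dvd (k - i) choose (t - i))" .

  interpret kernel "v choose k" ?n "transpose_mat W" by unfold_locales (rule W)
  let ?u = "vec ?n (\<lambda>_. 1 :: 'p mod_ring)"
  have "?n > 0" using tk assms(6) by simp
  hence u: "?u \<noteq> 0\<^sub>v ?n" by (metis index_vec index_zero_vec(1) zero_neq_one)
  have range: "vec ?n (\<lambda>i. f (rs i)) \<in> range (\<lambda>c. c \<cdot>\<^sub>v ?u) \<longleftrightarrow> (\<exists>c. \<forall>T\<in>subsets_of_card V t. f T = c)" for f
    by (auto simp: vec_eq_iff ball_rs[symmetric])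
  have dim: "kernel_dim (transpose_mat W) = dim"
    using W by (simp add: kernel_dim_def)
  have part2: "kernel_dim (transpose_mat W) = 1 \<and> basis {?u} \<longleftrightarrow>
      p dvd k choose t \<and> (\<forall>i\<in>{1..t}. \<not> p dvd (k - i) choose (t - i))" if "t > 0"
  proof -
    \<comment> \<open>A one-element basis already gives dimension 1, so only the basis condition
      remains.\<close>
    have "kernel_dim (transpose_mat W) = 1 \<and> basis {?u} \<longleftrightarrow> ?M = range (\<lambda>c. c \<cdot>\<^sub>v ?u)"
      using dim_eq_1_if_basis_singleton[of ?u] u by (auto simp: dim basis_singleton_iff)
    also have "\<dots> \<longleftrightarrow> (\<forall>f::'a set \<Rightarrow> 'p mod_ring.
        null_on_subsets V t k f \<longleftrightarrow> (\<exists>c. \<forall>T\<in>subsets_of_card V t. f T = c))"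
      by (subst subset_iff) (auto simp: range)
    also have "\<dots> \<longleftrightarrow> p dvd k choose t \<and> (\<forall>i\<in>{1..t}. \<not> p dvd (k - i) choose (t - i))"
      using null_on_subsets_iff_const_iff[OF assms(5) that tk, where 'b = "'p mod_ring"] by (simp add: zero)
    finally show ?thesis .
  qed
  show ?thesis
    using part1 part2 choose_not_dvd_iff_base_digits[OF assms(1) tk(1)]
      only_choose_dvd_iff_base_digits[OF assms(1) _ tk(1)] by simp
qed

end
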